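(* Let $E$ be a normed space and let $E_w$ denote $E$ endowed with the weak topology $\sigma(E,E')$. Then $E_w$ has the Pytkeev property if and only if $E$ is finite dimensional.
   Context: $E'$ denotes the topological dual of $E$. A topological space $X$ has the Pytkeev property if for any $A\subset X$ and each $x\in\overline{A}\setminus A$ there are infinite subsets $A_1,A_2,\dots$ of $A$ such that each neighborhood of $x$ contains some $A_n$. *)

theory Defs
  imports "HOL-Analysis.Analysis"
begin

text \<open>
  The topological dual of a real normed space is the library type
  \<^typ>\<open>'a \<Rightarrow>\<^sub>L real\<close>; the topology below is the coarsest one for which all its
  elements are continuous.
\<close>

definition weak_topology :: "'a::real_normed_vector topology" where
  "weak_topology =
     topology_generated_by {blinfun_apply f -` U | (f :: 'a \<Rightarrow>\<^sub>L real) U. open U}"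

definition pytkeev_property :: "'a topology \<Rightarrow> bool" where
  "pytkeev_property X \<longleftrightarrow>
     (\<forall>A x. A \<subseteq> topspace X \<and> x \<in> (X closure_of A) - A \<longrightarrow>
        (\<exists>B :: nat \<Rightarrow> 'a set.
           (\<forall>n. infinite (B n) \<and> B n \<subseteq> A) \<and>
           (\<forall>U. openin X U \<and> x \<in> U \<longrightarrow> (\<exists>n. B n \<subseteq> U))))"

end

theory Submission
  imports Defs
begin

text \<open>
  In finite dimension every linear functional is bounded, so the coordinate functionals
  of a basis belong to the dual. The identity is a combination of them, hence continuous
  from the weak topology to the norm topology, and the two topologies agree
  (\<open>weak_topology_finite_dimensional\<close>). In a metric space the traces of the balls
  around \<open>x\<close> on \<open>A\<close> form the sequence that the Pytkeev property asks for.

  In infinite dimension, assume the Pytkeev property. A singleton has no infinite subset, so no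
  point lies in the closure of another one: the dual separates points
  (\<open>functionals_separate_if_pytkeev\<close>). Any \<open>n\<close> functionals have a common zero on
  each sphere of an \<open>(n + 1)\<close>-dimensional subspace. That sphere is compact, so it has
  a finite net \<open>A n\<close> which contains, for any \<open>n\<close> functionals of norm at most 1, a
  point where all of them are at most \<open>1 / (n + 1)\<close> in absolute value; and if the radius is
  large, each point of \<open>A n\<close> takes a value at least \<open>n + 1\<close> in absolute value under some
  functional of norm at most 1 (\<open>finite_net_near_common_zeros\<close>). The first property puts
  0 into the weak closure of the union of the sets \<open>A n\<close>; the second one says that a subset
  of this union on which the dual unit ball is uniformly bounded meets only finitely many \<open>A n\<close>,
  and is therefore finite.

  Now let \<open>C n\<close> be infinite subsets of that union such that each weak neighbourhood of 0
  contains some \<open>C n\<close>. Each functional is bounded by 1 on some \<open>C n\<close>, namely on one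
  inside the neighbourhood where it is less than 1 in absolute value. By Baire's theorem in the
  dual, which is a Banach space, the unit ball of the dual is uniformly bounded on a single
  \<open>C n\<close> (\<open>bounded_on_some_piece\<close>), so that this \<open>C n\<close> is finite: a contradiction.
\<close>

section \<open>Finite-dimensional subspaces of a normed space\<close>

lemma closed_if_compact_cball_Int:
  fixes T :: "'a::real_normed_vector set"
  assumes "\<And>r. compact (cball 0 r \<inter> T)"
  shows "closed T"
  unfolding closed_sequential_limits
proof (intro allI impI, elim conjE)
  fix x l assume x: "\<forall>n. x n \<in> T" and l: "x \<longlonglongrightarrow> l"
  then obtain R where "\<And>n. norm (x n) \<le> R"
    using Bseq_def convergent_imp_Bseq convergent_def by metis
  then have "\<And>n. x n \<in> cball 0 R \<inter> T" using x by simp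
  then show "l \<in> T"
    using l closed_sequentially compact_imp_closed assms by blast
qed

text \<open>
  The constant is the distance from \<open>b\<close> to \<open>T\<close>, which is positive because \<open>T\<close> is closed;
  dividing by the coefficient turns the right-hand side into a distance from \<open>b\<close> to a point
  of \<open>T\<close>. This controls the \<open>b\<close>-coordinate of a vector by its norm.
\<close>

lemma coefficient_bound_closed_subspace:
  fixes b :: "'a::real_normed_vector"
  assumes "closed T" "subspace T" "b \<notin> T"
  obtains d where "d > 0" "\<And>c s. s \<in> T \<Longrightarrow> \<bar>c\<bar> * d \<le> norm (c *\<^sub>R b + s)"
proof
  have "T \<noteq> {}" using assms(2) subspace_0 by blast
  then show "infdist b T > 0"
    using assms by (metis in_closed_iff_infdist_zero infdist_nonneg less_eq_real_def)
  show "\<bar>c\<bar> * infdist b T \<le> norm (c *\<^sub>R b + s)" if "s \<in> T" for c s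
  proof (cases "c = 0")
    case False
    have "- (1/c) *\<^sub>R s \<in> T" using that assms(2) subspace_scale by blast
    then have "infdist b T \<le> dist b (- (1/c) *\<^sub>R s)"
      by (rule infdist_le)
    then have "\<bar>c\<bar> * infdist b T \<le> norm (c *\<^sub>R (b + (1/c) *\<^sub>R s))"
      by (simp add: dist_norm mult_left_mono)
    then show ?thesis using False by (simp add: scaleR_add_right)
  qed simp
qed

text \<open>
  Induction on the number of generators. When \<open>b\<close> is added outside of \<open>span S\<close>,
  a vector of norm at most \<open>r\<close> has a bounded \<open>b\<close>-coordinate, and then a bounded
  component in \<open>span S\<close>. The ball thus lies in the image of an interval times a ball
  of \<open>span S\<close>, which is compact by the induction hypothesis.
\<close>

lemma compact_cball_Int_span:
  fixes S :: "'a::real_normed_vector set"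
  assumes "finite S"
  shows "compact (cball 0 r \<inter> span S)"
  using assms
proof (induction S arbitrary: r)
  case empty
  then show ?case
    by (simp add: finite_imp_compact)
next
  case (insert b S)
  show ?case
  proof (cases "b \<in> span S")
    case True
    then show ?thesis using insert.IH by (simp add: span_redundant)
  next
    case False
    have "closed (span S)"
      using insert.IH by (rule closed_if_compact_cball_Int)
    then obtain d where d: "d > 0"
        and bound: "\<And>c s. s \<in> span S \<Longrightarrow> \<bar>c\<bar> * d \<le> norm (c *\<^sub>R b + s)"
      using False coefficient_bound_closed_subspace subspace_span by metis
    \<comment> \<open>If \<open>norm (c *\<^sub>R b + s) \<le> r\<close>, then \<open>\<bar>c\<bar> \<le> \<bar>r\<bar> / d\<close> and \<open>norm s \<le> R\<close>.\<close>
    define R where "R = \<bar>r\<bar> + \<bar>r\<bar> / d * norm b"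
    define K where "K = (\<lambda>(c, s). c *\<^sub>R b + s) ` ({- (\<bar>r\<bar> / d)..\<bar>r\<bar> / d} \<times> (cball 0 R \<inter> span S))"
    have "compact K"
      unfolding K_def
      by (intro compact_continuous_image compact_Times insert.IH compact_Icc)
         (auto simp: case_prod_unfold intro!: continuous_intros)
    moreover have "cball 0 r \<inter> span (insert b S) = cball 0 r \<inter> K"
    proof (intro subset_antisym subsetI)
      fix x assume x: "x \<in> cball 0 r \<inter> span (insert b S)"
      then obtain c where s: "x - c *\<^sub>R b \<in> span S"
        by (auto simp: span_insert)
      have nx: "norm x \<le> r" using x by simp
      have c: "\<bar>c\<bar> \<le> \<bar>r\<bar> / d"
        using bound[OF s, of c] nx d by (simp add: field_simps)
      have "norm (x - c *\<^sub>R b) \<le> norm x + \<bar>c\<bar> * norm b"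
        using norm_triangle_ineq4[of x "c *\<^sub>R b"] by simp
      also have "\<dots> \<le> R"
        unfolding R_def using nx c by (intro add_mono mult_right_mono) auto
      finally have "(c, x - c *\<^sub>R b) \<in> {- (\<bar>r\<bar> / d)..\<bar>r\<bar> / d} \<times> (cball 0 R \<inter> span S)"
        using s c by (auto simp: abs_le_iff)
      then have "x \<in> K"
        unfolding K_def by (rule rev_image_eqI) simp
      then show "x \<in> cball 0 r \<inter> K" using x by simp
    next
      fix x assume x: "x \<in> cball 0 r \<inter> K"
      then obtain c s where "x = c *\<^sub>R b + s" "s \<in> span S"
        by (auto simp: K_def)
      then have "x \<in> span (insert b S)"
        by (auto simp: span_insert intro!: exI[of _ c])
      then show "x \<in> cball 0 r \<inter> span (insert b S)" using x by blast
    qed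
    ultimately show ?thesis by (simp add: closed_Int_compact)
  qed
qed

text \<open>
  The span of the other basis vectors is closed, so \<open>coefficient_bound_closed_subspace\<close>
  bounds the coordinate at \<open>b\<close>.
\<close>

lemma bounded_linear_representation:
  fixes B :: "'a::real_normed_vector set"
  assumes "finite B" "independent B" "span B = UNIV" "b \<in> B"
  shows "bounded_linear (\<lambda>v. representation B v b)"
proof -
  let ?S = "span (B - {b})"
  have "finite (B - {b})" using assms by simp
  then have "closed ?S"
    by (intro closed_if_compact_cball_Int compact_cball_Int_span)
  moreover have "b \<notin> ?S"
    using assms dependent_def by blast
  ultimately obtain d where d: "d > 0"
      and bound: "\<And>c s. s \<in> ?S \<Longrightarrow> \<bar>c\<bar> * d \<le> norm (c *\<^sub>R b + s)"
    using coefficient_bound_closed_subspace subspace_span by metis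
  have "norm (representation B v b) \<le> norm v * (1/d)" for v
  proof -
    have "v = (\<Sum>w\<in>B. representation B v w *\<^sub>R w)"
      using sum_representation_eq[OF assms(2) _ assms(1)] assms(3) by (metis UNIV_I order_refl)
    then have "v = representation B v b *\<^sub>R b + (\<Sum>w\<in>B - {b}. representation B v w *\<^sub>R w)"
      using sum.remove[OF assms(1,4)] by metis
    moreover have "(\<Sum>w\<in>B - {b}. representation B v w *\<^sub>R w) \<in> ?S"
      by (intro span_sum span_scale span_base)
    ultimately have "\<bar>representation B v b\<bar> * d \<le> norm v"
      using bound by metis
    then show ?thesis
      using d by (simp add: field_simps)
  qed
  then show ?thesis
    using assms(2,3)
    by (intro bounded_linear_intro[of _ "1/d"]) (auto simp: representation_add representation_scale)
qed

text \<open>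
  If \<open>k\<close> functionals separate the points of \<open>V\<close> from 0, then \<open>V\<close> has dimension at most
  \<open>k\<close>. Each functional \<open>f\<close> costs at most one generator: if \<open>f u \<noteq> 0\<close>, then every vector of
  \<open>V\<close> differs by a multiple of \<open>u\<close> from one in the kernel of \<open>f\<close>.
\<close>

lemma common_kernel_trivial_imp_span:
  fixes F :: "('a::real_vector \<Rightarrow> real) set"
  assumes "finite F" "\<And>f. f \<in> F \<Longrightarrow> linear f" "subspace V"
    and "{v \<in> V. \<forall>f\<in>F. f v = 0} \<subseteq> {0}"
  shows "\<exists>S. finite S \<and> card S \<le> card F \<and> V \<subseteq> span S"
  using assms
proof (induction F arbitrary: V)
  case empty
  then show ?case by (intro exI[of _ "{}"]) auto
next
  case (insert f F)
  let ?W = "{v \<in> V. f v = 0}"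
  have f: "linear f" using insert.prems by simp
  have W: "subspace ?W"
    using insert.prems(2) f
    by (auto simp: subspace_def linear_add linear_scale linear_0)
  have "{v \<in> ?W. \<forall>f\<in>F. f v = 0} \<subseteq> {0}"
    using insert.prems(3) by auto
  from insert.IH[OF _ W this] insert.prems(1)
  obtain S where S: "finite S" "card S \<le> card F" "?W \<subseteq> span S"
    by auto
  show ?case
  proof (cases "\<exists>u\<in>V. f u \<noteq> 0")
    case True
    then obtain u where u: "u \<in> V" "f u \<noteq> 0" by blast
    have "V \<subseteq> span (insert u S)"
    proof
      fix v assume "v \<in> V"
      then have "v - (f v / f u) *\<^sub>R u \<in> ?W"
        using u insert.prems(2) f
        by (simp add: linear_diff linear_scale subspace_diff subspace_scale)
      then show "v \<in> span (insert u S)"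
        using S(3) by (auto simp: span_insert)
    qed
    moreover have "card (insert u S) \<le> card (insert f F)"
      using S insert.hyps by (simp add: card_insert_if)
    ultimately show ?thesis using S(1) by blast
  next
    case False
    then have "V \<subseteq> span S" using S(3) by auto
    then show ?thesis using S insert.hyps by (metis card_insert_disjoint le_Suc_eq)
  qed
qed

lemma common_zero_in_span:
  fixes F :: "('a::real_vector \<Rightarrow> real) set"
  assumes "finite F" "\<And>f. f \<in> F \<Longrightarrow> linear f" "independent S" "card F < card S"
  obtains v where "v \<in> span S" "v \<noteq> 0" "\<And>f. f \<in> F \<Longrightarrow> f v = 0"
proof (rule ccontr)
  assume "\<not> thesis"
  then have "{v \<in> span S. \<forall>f\<in>F. f v = 0} \<subseteq> {0}" using that by blast
  from common_kernel_trivial_imp_span[OF assms(1,2) subspace_span this]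
  obtain T where "finite T" "card T \<le> card F" "span S \<subseteq> span T" by blast
  then show False
    using independent_span_bound[of T S] assms(3,4) span_superset[of S]
    by (meson dual_order.trans not_le)
qed

section \<open>The weak topology\<close>

lemma openin_weak_vimage:
  fixes f :: "'a::real_normed_vector \<Rightarrow>\<^sub>L real"
  shows "open U \<Longrightarrow> openin weak_topology (blinfun_apply f -` U)"
  unfolding weak_topology_def by (rule topology_generated_by_Basis) blast

lemma topspace_weak_topology [simp]:
  "topspace (weak_topology :: 'a::real_normed_vector topology) = UNIV"
proof -
  have "blinfun_apply (0 :: 'a \<Rightarrow>\<^sub>L real) -` UNIV \<subseteq> topspace weak_topology"
    by (intro openin_subset openin_weak_vimage) simp
  then show ?thesis by auto
qed

lemma continuous_map_weak_blinfun:
  "continuous_map weak_topology euclideanreal (blinfun_apply f)"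
  using openin_weak_vimage[of _ f] by (auto simp: continuous_map_def vimage_def)

lemma open_if_openin_weak:
  assumes "openin weak_topology U"
  shows "open U"
proof -
  have "continuous_map euclidean weak_topology (\<lambda>x::'a. x)"
    unfolding weak_topology_def
  proof (rule continuous_on_generated_topo)
    fix U :: "'a set"
    assume "U \<in> {blinfun_apply f -` U |(f::'a \<Rightarrow>\<^sub>L real) U. open U}"
    then show "openin euclidean ((\<lambda>x. x) -` U \<inter> topspace euclidean)"
      by (auto intro!: open_vimage continuous_intros)
  next
    have "UNIV = blinfun_apply (0 :: 'a \<Rightarrow>\<^sub>L real) -` UNIV" by simp
    then show "(\<lambda>x. x) ` topspace euclidean \<subseteq> \<Union> {blinfun_apply f -` U |(f::'a \<Rightarrow>\<^sub>L real) U. open U}"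
      by blast
  qed
  then show ?thesis
    using assms by (auto simp: continuous_map_def)
qed

text \<open>
  The usual base of neighbourhoods. Induction over the generation of the topology: a subbasic
  set needs one functional, and an intersection of two sets needs the functionals of both and the
  smaller of the two tolerances.
\<close>

lemma weak_neighbourhoodE:
  fixes x :: "'a::real_normed_vector"
  assumes "openin weak_topology U" "x \<in> U"
  obtains \<Phi> :: "('a \<Rightarrow>\<^sub>L real) set" and e where "finite \<Phi>" "e > 0"
    "\<And>y. (\<And>f. f \<in> \<Phi> \<Longrightarrow> \<bar>blinfun_apply f y - blinfun_apply f x\<bar> < e) \<Longrightarrow> y \<in> U"
proof -
  have "generate_topology_on {blinfun_apply f -` U | (f :: 'a \<Rightarrow>\<^sub>L real) U. open U} U"
    using assms(1) unfolding weak_topology_def by (rule openin_topology_generated_by)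
  then have "\<exists>(\<Phi> :: ('a \<Rightarrow>\<^sub>L real) set) e. finite \<Phi> \<and> e > 0 \<and>
    (\<forall>y. (\<forall>f\<in>\<Phi>. \<bar>blinfun_apply f y - blinfun_apply f x\<bar> < e) \<longrightarrow> y \<in> U)"
    using assms(2)
  proof induction
    case (Int a b)
    then obtain \<Phi> \<Psi> :: "('a \<Rightarrow>\<^sub>L real) set" and d e where
      a: "finite \<Phi>" "d > 0" "\<And>y. (\<forall>f\<in>\<Phi>. \<bar>blinfun_apply f y - blinfun_apply f x\<bar> < d) \<Longrightarrow> y \<in> a" and
      b: "finite \<Psi>" "e > 0" "\<And>y. (\<forall>f\<in>\<Psi>. \<bar>blinfun_apply f y - blinfun_apply f x\<bar> < e) \<Longrightarrow> y \<in> b"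
      by auto
    show ?case
    proof (intro exI[of _ "\<Phi> \<union> \<Psi>"] exI[of _ "min d e"] conjI allI impI)
      fix y assume "\<forall>f\<in>\<Phi> \<union> \<Psi>. \<bar>blinfun_apply f y - blinfun_apply f x\<bar> < min d e"
      then show "y \<in> a \<inter> b" using a(3)[of y] b(3)[of y] by simp
    qed (use a b in auto)
  next
    case (UN K)
    then obtain k where k: "k \<in> K" "x \<in> k" by blast
    from UN.IH[OF this] obtain \<Phi> :: "('a \<Rightarrow>\<^sub>L real) set" and e where "finite \<Phi>" "e > 0"
      "\<forall>y. (\<forall>f\<in>\<Phi>. \<bar>blinfun_apply f y - blinfun_apply f x\<bar> < e) \<longrightarrow> y \<in> k"
      by blast
    with k(1) show ?case by (intro exI[of _ \<Phi>] exI[of _ e]) auto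
  next
    case (Basis s)
    then obtain f :: "'a \<Rightarrow>\<^sub>L real" and V where s: "s = blinfun_apply f -` V" "open V"
      by blast
    then have "blinfun_apply f x \<in> V" using Basis(2) by simp
    then obtain e where "e > 0" "\<And>t. \<bar>t - blinfun_apply f x\<bar> < e \<Longrightarrow> t \<in> V"
      using s(2) unfolding open_dist dist_real_def by blast
    then show ?case
      using s(1) by (intro exI[of _ "{f}"] exI[of _ e]) simp
  qed simp
  then obtain \<Phi> :: "('a \<Rightarrow>\<^sub>L real) set" and e where "finite \<Phi>" "e > 0"
    "\<forall>y. (\<forall>f\<in>\<Phi>. \<bar>blinfun_apply f y - blinfun_apply f x\<bar> < e) \<longrightarrow> y \<in> U"
    by (elim exE conjE)
  then show thesis by (intro that[of \<Phi> e]) auto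
qed

text \<open>
  The coordinate functionals are weakly continuous. As the identity is
  \<open>v \<mapsto> (\<Sum>b\<in>B. coord b v *\<^sub>R b)\<close>, it is continuous from the weak topology to the norm topology.
\<close>

lemma weak_topology_finite_dimensional:
  fixes B :: "'a::real_normed_vector set"
  assumes "finite B" "independent B" "span B = UNIV"
  shows "(weak_topology :: 'a topology) = euclidean"
proof (rule topology_eq[THEN iffD2], intro allI iffI)
  fix U :: "'a set"
  show "openin euclidean U" if "openin weak_topology U"
    using that open_if_openin_weak by simp
  define coord where "coord b = Blinfun (\<lambda>v. representation B v b)" for b
  have coord: "blinfun_apply (coord b) v = representation B v b" if "b \<in> B" for b v
    unfolding coord_def
    using bounded_linear_Blinfun_apply[OF bounded_linear_representation[OF assms that]] by simp
  have "(\<Sum>b\<in>B. blinfun_apply (coord b) v *\<^sub>R b) = v" for v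
  proof -
    have "(\<Sum>b\<in>B. representation B v b *\<^sub>R b) = v"
      using sum_representation_eq[OF assms(2) _ assms(1)] assms(3) by (metis UNIV_I order_refl)
    then show ?thesis by (simp add: coord)
  qed
  moreover have "continuous_map weak_topology euclidean (\<lambda>v. \<Sum>b\<in>B. blinfun_apply (coord b) v *\<^sub>R b)"
  proof (rule continuous_map_sum[OF assms(1)])
    fix b :: 'a
    have "continuous_map euclideanreal euclidean (\<lambda>t. t *\<^sub>R b)"
      by (auto intro!: continuous_intros)
    from continuous_map_compose[OF continuous_map_weak_blinfun this]
    show "continuous_map weak_topology euclidean (\<lambda>v. blinfun_apply (coord b) v *\<^sub>R b)"
      by (simp add: o_def)
  qed
  ultimately have "continuous_map weak_topology euclidean (\<lambda>v::'a. v)" by simp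
  then show "openin weak_topology U" if "openin euclidean U"
    using that by (auto simp: continuous_map_def)
qed

section \<open>The Pytkeev property\<close>

lemma pytkeev_property_euclidean:
  "pytkeev_property (euclidean :: 'a::metric_space topology)"
  unfolding pytkeev_property_def
proof (intro allI impI)
  fix A :: "'a set" and x
  assume "A \<subseteq> topspace euclidean \<and> x \<in> (euclidean closure_of A) - A"
  then have "x islimpt A" by (auto simp: closure_def)
  then have inf: "infinite (A \<inter> ball x (1 / Suc n))" for n
    by (simp add: islimpt_eq_infinite_ball)
  show "\<exists>B::nat \<Rightarrow> 'a set. (\<forall>n. infinite (B n) \<and> B n \<subseteq> A) \<and>
      (\<forall>U. openin euclidean U \<and> x \<in> U \<longrightarrow> (\<exists>n. B n \<subseteq> U))"
  proof (intro exI[of _ "\<lambda>n. A \<inter> ball x (1 / Suc n)"] conjI allI impI)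
    fix U assume "openin euclidean U \<and> x \<in> U"
    then obtain e where e: "e > 0" "ball x e \<subseteq> U"
      by (auto simp: open_contains_ball)
    then obtain n where "1 / Suc n < e"
      using nat_approx_posE by metis
    then have "A \<inter> ball x (1 / Suc n) \<subseteq> U" using e(2) by auto
    then show "\<exists>n. A \<inter> ball x (1 / Suc n) \<subseteq> U" by blast
  qed (use inf in auto)
qed

text \<open>
  If every functional vanished at \<open>v\<close>, then every weak neighbourhood of 0 would contain
  \<open>v\<close>, so 0 would be in the closure of \<open>{v}\<close>; but \<open>{v}\<close> has no infinite subset.
\<close>

lemma functionals_separate_if_pytkeev:
  fixes v :: "'a::real_normed_vector"
  assumes "pytkeev_property (weak_topology :: 'a topology)" "v \<noteq> 0"
  shows "\<exists>f :: 'a \<Rightarrow>\<^sub>L real. f v \<noteq> 0"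
proof (rule ccontr)
  assume v: "\<not> ?thesis"
  have "0 \<in> weak_topology closure_of {v}"
    unfolding in_closure_of
  proof (intro conjI allI impI)
    fix U :: "'a set" assume U: "0 \<in> U \<and> openin weak_topology U"
    then obtain \<Phi> :: "('a \<Rightarrow>\<^sub>L real) set" and e where "e > 0"
      "\<And>y. (\<And>f. f \<in> \<Phi> \<Longrightarrow> \<bar>blinfun_apply f y - blinfun_apply f 0\<bar> < e) \<Longrightarrow> y \<in> U"
      using weak_neighbourhoodE by metis
    then have "v \<in> U" using v by (simp add: blinfun.zero_right)
    then show "\<exists>y. y \<in> {v} \<and> y \<in> U" by blast
  qed simp
  then have "0 \<in> (weak_topology closure_of {v}) - {v}" using assms(2) by simp
  then obtain B :: "nat \<Rightarrow> 'a set" where "\<And>n. infinite (B n) \<and> B n \<subseteq> {v}"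
    using assms(1) unfolding pytkeev_property_def
    by (metis subset_UNIV topspace_weak_topology)
  then show False by (meson finite.emptyI finite_insert finite_subset)
qed

text \<open>
  The set \<open>A\<close> is a net of the sphere of radius \<open>r\<close> in \<open>span S\<close>. Fewer than \<open>card S\<close>
  functionals have a common zero on this sphere, and a point of the net within distance \<open>e\<close> of
  that zero satisfies the first estimate. For the second one, compactness of the unit sphere of
  \<open>span S\<close> gives a \<open>d > 0\<close> such that each of its points is mapped to absolute value at least
  \<open>d\<close> by a functional of norm at most 1; then \<open>r\<close> is chosen so large that \<open>r * d \<ge> R\<close>.
\<close>

lemma finite_net_near_common_zeros:
  fixes S :: "'a::real_normed_vector set"
  assumes sep: "\<And>v::'a. v \<noteq> 0 \<Longrightarrow> \<exists>f :: 'a \<Rightarrow>\<^sub>L real. f v \<noteq> 0"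
    and S: "finite S" "independent S" "n < card S" and "e > 0"
  obtains A where "finite A"
    "\<And>\<Phi>. finite \<Phi> \<Longrightarrow> card \<Phi> \<le> n \<Longrightarrow> \<exists>a\<in>A. \<forall>f\<in>\<Phi>. \<bar>blinfun_apply f a\<bar> \<le> norm f * e"
    "\<And>a. a \<in> A \<Longrightarrow> \<exists>g :: 'a \<Rightarrow>\<^sub>L real. norm g \<le> 1 \<and> R \<le> \<bar>blinfun_apply g a\<bar>"
proof -
  define T where "T = sphere 0 1 \<inter> span S"
  have "T = (cball 0 1 \<inter> span S) \<inter> {v. norm v = 1}" unfolding T_def by auto
  moreover have "closed {v :: 'a. norm v = 1}"
    by (intro closed_Collect_eq continuous_intros)
  ultimately have "compact T"
    using compact_Int_closed[OF compact_cball_Int_span[OF S(1)]] by metis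
  have "\<exists>d>0. \<forall>v\<in>T. \<exists>g :: 'a \<Rightarrow>\<^sub>L real. norm g \<le> 1 \<and> d \<le> \<bar>blinfun_apply g v\<bar>"
  proof (rule ccontr)
    assume *: "\<not> ?thesis"
    \<comment> \<open>Points with ever smaller values accumulate at a point where all functionals vanish.\<close>
    have "\<exists>v\<in>T. \<forall>g :: 'a \<Rightarrow>\<^sub>L real. norm g \<le> 1 \<longrightarrow> \<bar>blinfun_apply g v\<bar> < 1 / Suc k" for k
    proof -
      have "0 < 1 / real (Suc k)" by simp
      then show ?thesis using * by (metis not_le)
    qed
    then obtain x where x: "\<And>k. x k \<in> T"
      "\<And>k (g :: 'a \<Rightarrow>\<^sub>L real). norm g \<le> 1 \<Longrightarrow> \<bar>blinfun_apply g (x k)\<bar> < 1 / Suc k"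
      by metis
    obtain l s where l: "l \<in> T" "strict_mono s" "(x \<circ> s) \<longlonglongrightarrow> l"
      using \<open>compact T\<close> x(1) unfolding compact_def by metis
    have "l \<noteq> 0" using l(1) by (auto simp: T_def)
    then obtain f :: "'a \<Rightarrow>\<^sub>L real" where f: "f l \<noteq> 0" using sep by blast
    then have "norm f \<noteq> 0" by auto
    define g where "g = (1 / norm f) *\<^sub>R f"
    have g: "norm g \<le> 1" "g l \<noteq> 0"
      using f \<open>norm f \<noteq> 0\<close> by (auto simp: g_def scaleR_blinfun.rep_eq)
    have "(\<lambda>k. g (x (s k))) \<longlonglongrightarrow> g l"
      using l(3) unfolding o_def by (intro tendsto_intros)
    moreover have "(\<lambda>k. g (x (s k))) \<longlonglongrightarrow> 0"
    proof (rule Lim_null_comparison)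
      have "(\<lambda>k. 1 / real (Suc k)) \<longlonglongrightarrow> 0"
        using LIMSEQ_inverse_real_of_nat by (simp add: inverse_eq_divide)
      from LIMSEQ_subseq_LIMSEQ[OF this l(2)]
      show "(\<lambda>k. 1 / real (Suc (s k))) \<longlonglongrightarrow> 0" by (simp add: o_def)
      show "\<forall>\<^sub>F k in sequentially. norm (g (x (s k))) \<le> 1 / real (Suc (s k))"
        using x(2)[OF g(1)] by (intro always_eventually) (simp add: less_imp_le)
    qed
    ultimately show False using g(2) LIMSEQ_unique by blast
  qed
  then obtain d where d: "d > 0"
    "\<And>v. v \<in> T \<Longrightarrow> \<exists>g :: 'a \<Rightarrow>\<^sub>L real. norm g \<le> 1 \<and> d \<le> \<bar>blinfun_apply g v\<bar>"
    by blast
  define r where "r = (\<bar>R\<bar> + 1) / d"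
  have r: "r > 0" "R \<le> r * d"
    using d(1) by (auto simp: r_def)
  \<comment> \<open>Scaling by \<open>r\<close> turns a net of mesh \<open>e / r\<close> in the unit sphere into one of mesh \<open>e\<close>.\<close>
  have "T \<subseteq> (\<Union>x\<in>T. ball x (e / r))"
    using \<open>e > 0\<close> r(1) by auto
  then obtain C where C: "C \<subseteq> T" "finite C" "T \<subseteq> (\<Union>x\<in>C. ball x (e / r))"
    using compactE_image[OF \<open>compact T\<close>, of T "\<lambda>x. ball x (e / r)"] by auto
  show thesis
  proof (rule that[of "(\<lambda>v. r *\<^sub>R v) ` C"])
    show "finite ((\<lambda>v. r *\<^sub>R v) ` C)" using C(2) by simp
    show "\<exists>g :: 'a \<Rightarrow>\<^sub>L real. norm g \<le> 1 \<and> R \<le> \<bar>blinfun_apply g a\<bar>" if a: "a \<in> (\<lambda>v. r *\<^sub>R v) ` C" for a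
    proof -
      obtain v where v: "v \<in> T" "a = r *\<^sub>R v" using a C(1) by blast
      then obtain g :: "'a \<Rightarrow>\<^sub>L real" where g: "norm g \<le> 1" "d \<le> \<bar>blinfun_apply g v\<bar>" using d(2) by blast
      have "R \<le> r * \<bar>blinfun_apply g v\<bar>"
        using r g(2) by (meson less_imp_le mult_left_mono order_trans)
      then have "R \<le> \<bar>blinfun_apply g a\<bar>"
        using r(1) by (simp add: v(2) blinfun.scaleR_right abs_mult)
      then show ?thesis using g(1) by blast
    qed
    fix \<Phi> :: "('a \<Rightarrow>\<^sub>L real) set"
    assume \<Phi>: "finite \<Phi>" "card \<Phi> \<le> n"
    have "card (blinfun_apply ` \<Phi>) < card S"
      using card_image_le[OF \<Phi>(1), of blinfun_apply] \<Phi>(2) S(3) by linarith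
    then obtain v where v: "v \<in> span S" "v \<noteq> 0" "\<And>f. f \<in> blinfun_apply ` \<Phi> \<Longrightarrow> f v = 0"
      using common_zero_in_span[of "blinfun_apply ` \<Phi>" S] \<Phi>(1) S(2)
      by (metis finite_imageI imageE blinfun.bounded_linear_right bounded_linear.linear)
    define w where "w = (1 / norm v) *\<^sub>R v"
    have "w \<in> T" using v by (auto simp: w_def T_def span_scale)
    then obtain c where c: "c \<in> C" "dist c w < e / r" using C(3) by auto
    have "\<bar>blinfun_apply f (r *\<^sub>R c)\<bar> \<le> norm f * e" if "f \<in> \<Phi>" for f
    proof -
      have "blinfun_apply f w = 0" using v(3) that by (simp add: w_def blinfun.scaleR_right)
      then have "\<bar>blinfun_apply f (r *\<^sub>R c)\<bar> = r * norm (blinfun_apply f (c - w))"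
        using r(1) by (simp add: blinfun.scaleR_right blinfun.diff_right abs_mult)
      also have "\<dots> \<le> r * (norm f * norm (c - w))"
        using r(1) by (intro mult_left_mono norm_blinfun) auto
      also have "\<dots> \<le> r * (norm f * (e / r))"
        using r(1) c(2) by (intro mult_left_mono) (auto simp: dist_norm)
      also have "\<dots> = norm f * e" using r(1) by simp
      finally show ?thesis .
    qed
    then show "\<exists>a\<in>(\<lambda>v. r *\<^sub>R v) ` C. \<forall>f\<in>\<Phi>. \<bar>blinfun_apply f a\<bar> \<le> norm f * e"
      using c(1) by blast
  qed
qed

lemma countable_closed_cover_has_interior:
  fixes F :: "nat \<Rightarrow> 'a::{real_normed_vector,complete_space} set"
  assumes "\<And>n. closed (F n)" "(\<Union>n. F n) = UNIV"
  obtains n x r where "r > 0" "cball x r \<subseteq> F n"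
proof -
  have "\<exists>n. interior (F n) \<noteq> {}"
  proof (rule ccontr)
    assume *: "\<not> ?thesis"
    have "Met_TC.mcomplete TYPE('a)" by (simp add: complete_UNIV)
    from Met_TC.metric_Baire_category_alt[OF this, of "range F"]
    have "interior (\<Union>n. F n) = {}" using * assms(1) by auto
    then show False using assms(2) by simp
  qed
  then show thesis using that by (metis equals0I mem_interior_cball)
qed

text \<open>
  A form of the uniform boundedness principle. The functionals bounded by 1 on \<open>B n\<close> form a
  closed set, and these sets cover the dual. By Baire's theorem one of them contains a ball of
  some radius \<open>r\<close>; subtracting its centre shows that the functionals of norm at most \<open>r\<close> are
  bounded by 2 on \<open>B n\<close>.
\<close>

lemma bounded_on_some_piece:
  fixes B :: "nat \<Rightarrow> 'a::real_normed_vector set"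
  assumes "\<And>f :: 'a \<Rightarrow>\<^sub>L real. \<exists>n. \<forall>x\<in>B n. \<bar>f x\<bar> \<le> 1"
  obtains n M where "\<And>x (g :: 'a \<Rightarrow>\<^sub>L real). x \<in> B n \<Longrightarrow> norm g \<le> 1 \<Longrightarrow> \<bar>blinfun_apply g x\<bar> \<le> M"
proof -
  define F where "F n = (\<Inter>x\<in>B n. {f :: 'a \<Rightarrow>\<^sub>L real. \<bar>f x\<bar> \<le> 1})" for n
  have "closed (F n)" for n
    unfolding F_def by (intro closed_INT ballI closed_Collect_le continuous_intros)
  moreover have "(\<Union>n. F n) = UNIV" using assms by (auto simp: F_def)
  ultimately obtain n f r where r: "r > 0" "cball f r \<subseteq> F n"
    using countable_closed_cover_has_interior by metis
  have "\<bar>blinfun_apply g x\<bar> \<le> 2 / r" if x: "x \<in> B n" and g: "norm g \<le> 1" for x and g :: "'a \<Rightarrow>\<^sub>L real"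
  proof -
    have "f + r *\<^sub>R g \<in> cball f r" "f \<in> cball f r"
      using r(1) g by (auto simp: dist_norm mult_left_le)
    then have "f + r *\<^sub>R g \<in> F n" "f \<in> F n" using r(2) by auto
    then have "\<bar>f x + r * g x\<bar> \<le> 1" "\<bar>f x\<bar> \<le> 1"
      using x by (auto simp: F_def plus_blinfun.rep_eq scaleR_blinfun.rep_eq)
    then have "\<bar>r * g x\<bar> \<le> 2" by linarith
    then show ?thesis using r(1) by (simp add: abs_mult field_simps)
  qed
  then show thesis using that by blast
qed

text \<open>
  The set that violates the Pytkeev property at 0 is the union of the nets
  from \<open>finite_net_near_common_zeros\<close>, taken on spheres of subspaces of dimension \<open>n + 1\<close> with
  tolerance \<open>1 / (n + 1)\<close> and lower bound \<open>n + 1\<close>.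
\<close>

lemma not_pytkeev_if_infinite_dimensional:
  fixes B :: "'a::real_normed_vector set"
  assumes "independent B" "infinite B"
  shows "\<not> pytkeev_property (weak_topology :: 'a topology)"
proof
  assume pyt: "pytkeev_property (weak_topology :: 'a topology)"
  have "\<exists>A. finite A \<and>
      (\<forall>\<Phi>. finite \<Phi> \<and> card \<Phi> \<le> n \<longrightarrow> (\<exists>a\<in>A. \<forall>f\<in>\<Phi>. \<bar>blinfun_apply f a\<bar> \<le> norm f * (1 / real (Suc n)))) \<and>
      (\<forall>a\<in>A. \<exists>g :: 'a \<Rightarrow>\<^sub>L real. norm g \<le> 1 \<and> real (Suc n) \<le> \<bar>blinfun_apply g a\<bar>)" for n
  proof -
    obtain S where S: "S \<subseteq> B" "finite S" "card S = Suc n"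
      using infinite_arbitrarily_large[OF assms(2)] by blast
    have ind: "independent S" using assms(1) S(1) independent_mono by blast
    have "n < card S" "0 < 1 / real (Suc n)" using S(3) by auto
    from finite_net_near_common_zeros[OF functionals_separate_if_pytkeev[OF pyt] S(2) ind this,
        of "real (Suc n)"]
    show ?thesis by metis
  qed
  then obtain A where fin: "\<And>n. finite (A n)"
    and small: "\<And>n \<Phi>. finite \<Phi> \<Longrightarrow> card \<Phi> \<le> n \<Longrightarrow>
      \<exists>a\<in>A n. \<forall>f\<in>\<Phi>. \<bar>blinfun_apply f a\<bar> \<le> norm f * (1 / real (Suc n))"
    and large: "\<And>n a. a \<in> A n \<Longrightarrow> \<exists>g :: 'a \<Rightarrow>\<^sub>L real. norm g \<le> 1 \<and> real (Suc n) \<le> \<bar>blinfun_apply g a\<bar>"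
    by metis
  let ?A = "\<Union>n. A n"
  have "0 \<in> weak_topology closure_of ?A"
    unfolding in_closure_of
  proof (intro conjI allI impI)
    fix U :: "'a set" assume "0 \<in> U \<and> openin weak_topology U"
    then obtain \<Phi> :: "('a \<Rightarrow>\<^sub>L real) set" and e where U: "finite \<Phi>" "e > 0"
      "\<And>y. (\<And>f. f \<in> \<Phi> \<Longrightarrow> \<bar>blinfun_apply f y - blinfun_apply f 0\<bar> < e) \<Longrightarrow> y \<in> U"
      using weak_neighbourhoodE by metis
    \<comment> \<open>Take \<open>n\<close> at least the number of functionals, and so large that \<open>norm f / (n + 1) < e\<close>.\<close>
    define M where "M = (\<Sum>f\<in>\<Phi>. norm f)"
    obtain m :: nat where m: "M / e < m" using reals_Archimedean2 by blast
    define n where "n = max m (card \<Phi>)"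
    obtain a where a: "a \<in> A n" "\<And>f. f \<in> \<Phi> \<Longrightarrow> \<bar>blinfun_apply f a\<bar> \<le> norm f * (1 / real (Suc n))"
      using small[OF U(1), of n] by (auto simp: n_def)
    have "M / e < Suc n" using m by (simp add: n_def)
    then have "M * (1 / Suc n) < e" using U(2) by (simp add: field_simps)
    moreover have "norm f * (1 / real (Suc n)) \<le> M * (1 / Suc n)" if "f \<in> \<Phi>" for f
      unfolding M_def using that U(1) by (intro mult_right_mono member_le_sum) auto
    ultimately have "a \<in> U"
      using a(2) by (intro U(3)) (force simp: blinfun.zero_right)
    then show "\<exists>y. y \<in> ?A \<and> y \<in> U" using a(1) by blast
  qed simp
  moreover have "0 \<notin> ?A"
    using large by (force simp: blinfun.zero_right)
  ultimately have "0 \<in> (weak_topology closure_of ?A) - ?A" by blast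
  then obtain C :: "nat \<Rightarrow> 'a set" where C: "\<And>n. infinite (C n)" "\<And>n. C n \<subseteq> ?A"
    "\<And>U. openin weak_topology U \<Longrightarrow> 0 \<in> U \<Longrightarrow> \<exists>n. C n \<subseteq> U"
    using pyt unfolding pytkeev_property_def by (metis subset_UNIV topspace_weak_topology)
  have "\<exists>n. \<forall>x\<in>C n. \<bar>f x\<bar> \<le> 1" for f :: "'a \<Rightarrow>\<^sub>L real"
  proof -
    have "\<exists>n. C n \<subseteq> blinfun_apply f -` {-1<..<1}"
      by (intro C(3) openin_weak_vimage) (auto simp: blinfun.zero_right)
    then obtain n where "C n \<subseteq> blinfun_apply f -` {-1<..<1}" ..
    then have "f x \<in> {-1<..<1}" if "x \<in> C n" for x using that by blast
    then have "\<forall>x\<in>C n. \<bar>f x\<bar> \<le> 1" by (simp add: abs_le_iff less_imp_le minus_le_iff)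
    then show ?thesis ..
  qed
  then obtain n M where M: "\<And>x (g :: 'a \<Rightarrow>\<^sub>L real). x \<in> C n \<Longrightarrow> norm g \<le> 1 \<Longrightarrow> \<bar>blinfun_apply g x\<bar> \<le> M"
    using bounded_on_some_piece by metis
  obtain N :: nat where N: "M < N" using reals_Archimedean2 by blast
  have "C n \<subseteq> (\<Union>k<N. A k)"
  proof
    fix x assume x: "x \<in> C n"
    then obtain k where k: "x \<in> A k" using C(2) by blast
    then have "real (Suc k) \<le> M" using large M[OF x] order_trans by meson
    then have "k < N" using N by simp
    then show "x \<in> (\<Union>k<N. A k)" using k by blast
  qed
  then have "finite (C n)" using fin by (meson finite_UN_I finite_lessThan finite_subset)
  then show False using C(1) by blast
qed

theorem theorem1p4:
  "pytkeev_property (weak_topology :: 'a::real_normed_vector topology) \<longleftrightarrow>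
     (\<exists>B :: 'a set. finite_dimensional_vector_space scaleR B)"
proof
  assume pyt: "pytkeev_property (weak_topology :: 'a topology)"
  obtain B :: "'a set" where B: "independent B" "UNIV \<subseteq> span B"
    by (rule maximal_independent_subset[of UNIV])
  then have "finite B" using pyt not_pytkeev_if_infinite_dimensional by blast
  then have "finite_dimensional_vector_space scaleR B"
    using B by unfold_locales (auto simp: dependent_raw_def span_raw_def)
  then show "\<exists>B :: 'a set. finite_dimensional_vector_space scaleR B" ..
next
  assume "\<exists>B :: 'a set. finite_dimensional_vector_space scaleR B"
  then obtain B :: "'a set" where "finite_dimensional_vector_space scaleR B" ..
  then have "finite B" "independent B" "span B = UNIV"
    by (auto simp: finite_dimensional_vector_space_def finite_dimensional_vector_space_axioms_def
        dependent_raw_def span_raw_def)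
  then show "pytkeev_property (weak_topology :: 'a topology)"
    using weak_topology_finite_dimensional pytkeev_property_euclidean by metis
qed

end
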